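(* Let $N\ge 2$ and let $\Omega\subset\mathbb{R}^N$ be a domain that is radially symmetric with respect to the origin (an annulus, a ball, or the exterior of a ball, centered at the origin). Let $u\in L^p(\Omega)$ for some $p\in[1,+\infty)$, and assume that for every $H\in\mathcal{H}_0$ one has either $u=u_H$ or $\sigma_H u=u_H$. Then $u$ is foliated Schwarz symmetric with respect to some point $P\in\mathcal{S}^{N-1}$.
   Context: Functions $u:\Omega\to\mathbb{R}$ are extended to $\mathbb{R}^N$ by $u(x)=0$ for $x\in\mathbb{R}^N\setminus\Omega$. Measurable functions are identified when they agree almost everywhere, and equalities between functions are understood a.e. $\mathcal{H}_0$ is the family of open half-spaces $H$ in $\mathbb{R}^N$ with $0\in\partial H$. For $H\in\mathcal{H}_0$, $\sigma_H$ denotes the reflection in the hyperplane $\partial H$, and for a function $u$ one writes $\sigma_H u(x):=u(\sigma_H x)$. The two-point rearrangement of $u$ with respect to $H$ is $$u_H(x):=\max\{u(x),u(\sigma_H x)\}\ \text{ if } x\in H,\qquad u_H(x):=\min\{u(x),u(\sigma_H x)\}\ \text{ if } x\notin H.$$ $\mathcal{S}^{N-1}$ is the unit sphere of $\mathbb{R}^N$ and $P_N=(1,0,\dots,0)$. The foliated Schwarz symmetrization $u^*$ of a measurable $u:\Omega\to\mathbb{R}$ is the (unique) function such that: (1) there is a function $w:[0,+\infty)\times[0,\pi)\to\mathbb{R}$, $w=w(r,\vartheta)$, nonincreasing in $\vartheta$, with $u^*(x)=w(|x|,\arccos(x_1/|x|))$ for $x\in\Omega$; (2) $\mathcal{L}^{N-1}\{x: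 a<u(x)\le b,\ |x|=r\}=\mathcal{L}^{N-1}\{x: a<u^*(x)\le b,\ |x|=r\}$ for all real $a<b$ and all $r\ge 0$, where $\mathcal{L}^{N-1}$ denotes $(N-1)$-dimensional surface measure on the sphere $\{|x|=r\}$ (for a.e.-defined functions, (2) is required for a.e. $r$). The function $u$ is foliated Schwarz symmetric with respect to $P\in\mathcal{S}^{N-1}$ if there is a rotation $\rho$ about the origin with $\rho(P_N)=P$ and $u(\rho(\cdot))=u^*(\cdot)$.
   Formalization: In the definition of u*, w(r,·) is required to be nonincreasing only on (0,π), not [0,π): a finite value at angle 0 would force u to be bounded above on almost every sphere, which fails e.g. for u=|θ|^(-1/(2p)) on a planar annulus. *)

theory Defs
  imports "HOL-Analysis.Analysis"
begin

definition radially_symmetric :: "'a::real_normed_vector set \<Rightarrow> bool" where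
  "radially_symmetric \<Omega> \<longleftrightarrow> (\<forall>x y. x \<in> \<Omega> \<longrightarrow> norm y = norm x \<longrightarrow> y \<in> \<Omega>)"

definition in_Lp :: "real \<Rightarrow> 'a::euclidean_space set \<Rightarrow> ('a \<Rightarrow> real) \<Rightarrow> bool" where
  "in_Lp p \<Omega> u \<longleftrightarrow>
     u \<in> borel_measurable (lebesgue_on \<Omega>) \<and> integrable (lebesgue_on \<Omega>) (\<lambda>x. \<bar>u x\<bar> powr p)"

definition zero_extension :: "'a set \<Rightarrow> ('a \<Rightarrow> real) \<Rightarrow> 'a \<Rightarrow> real" where
  "zero_extension \<Omega> u = (\<lambda>x. if x \<in> \<Omega> then u x else 0)"

text \<open>Open half-spaces with the origin on their boundary.\<close>

definition half_spaces0 :: "'a::euclidean_space set set" where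
  "half_spaces0 = {H. (\<exists>a b. a \<noteq> 0 \<and> H = {x. b < a \<bullet> x}) \<and> 0 \<in> frontier H}"

text \<open>For a half-space \<open>H\<close> the frontier is a hyperplane, the closest point is the orthogonal
  projection onto it, and the map below is the reflection in it.\<close>

definition reflection :: "'a::euclidean_space set \<Rightarrow> 'a \<Rightarrow> 'a" where
  "reflection H x = 2 *\<^sub>R closest_point (frontier H) x - x"

definition two_point_rearrangement ::
    "'a::euclidean_space set \<Rightarrow> ('a \<Rightarrow> real) \<Rightarrow> 'a \<Rightarrow> real" where
  "two_point_rearrangement H u x =
     (if x \<in> H then max (u x) (u (reflection H x)) else min (u x) (u (reflection H x)))"

text \<open>Surface measure of the part of \<open>A\<close> on the sphere of radius \<open>r\<close> about the origin, as it is
  introduced with polar coordinates: on the unit sphere it is \<open>N\<close> times the Lebesgue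
  measure of the cone over the set inside the unit ball, and it scales with \<open>r ^ (N - 1)\<close>.\<close>

definition sphere_measure :: "real \<Rightarrow> (real ^ 'n) set \<Rightarrow> ennreal" where
  "sphere_measure r A =
     ennreal (real CARD('n) * r ^ (CARD('n) - 1)) *
       emeasure lebesgue {y. 0 < norm y \<and> norm y < 1 \<and> (r / norm y) *\<^sub>R y \<in> A}"

text \<open>\<open>is_foliated_schwarz_symmetrization k \<Omega> u v\<close> says that \<open>v\<close> is (a representative of) the
  foliated Schwarz symmetrization of \<open>u\<close>. The index \<open>k\<close> names the coordinate that plays the
  role of the first one, so that the pole is \<open>axis k 1\<close>. Functions are taken modulo null sets.
  The angle 0 (a null set of points, the positive polar axis) is left out of the
  monotonicity: with a finite value at angle 0 it would force \<open>u\<close> to be essentially bounded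
  above on almost every sphere, which fails for general \<open>u\<close> in \<open>L\<^sup>p\<close>. For functions bounded
  above on the spheres the two versions agree, since the value at angle 0 can be redefined.\<close>

definition is_foliated_schwarz_symmetrization ::
    "'n \<Rightarrow> (real ^ 'n) set \<Rightarrow> (real ^ 'n \<Rightarrow> real) \<Rightarrow> (real ^ 'n \<Rightarrow> real) \<Rightarrow> bool" where
  "is_foliated_schwarz_symmetrization k \<Omega> u v \<longleftrightarrow>
     v \<in> borel_measurable (lebesgue_on \<Omega>) \<and>
     (\<exists>w :: real \<Rightarrow> real \<Rightarrow> real.
        (\<forall>r\<ge>0. antimono_on {0<..<pi} (w r)) \<and>
        (AE x in lebesgue_on \<Omega>. v x = w (norm x) (arccos (x $ k / norm x)))) \<and>
     (AE r in lborel. 0 \<le> r \<longrightarrow>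
        (\<forall>a b. a < b \<longrightarrow>
           sphere_measure r {x \<in> \<Omega>. a < u x \<and> u x \<le> b \<and> norm x = r} =
           sphere_measure r {x \<in> \<Omega>. a < v x \<and> v x \<le> b \<and> norm x = r}))"

definition foliated_schwarz_symmetric ::
    "'n \<Rightarrow> (real ^ 'n) set \<Rightarrow> (real ^ 'n \<Rightarrow> real) \<Rightarrow> real ^ 'n \<Rightarrow> bool" where
  "foliated_schwarz_symmetric k \<Omega> u P \<longleftrightarrow>
     (\<exists>(Q :: real ^ 'n ^ 'n) v.
        rotation_matrix Q \<and> Q *v axis k 1 = P \<and>
        is_foliated_schwarz_symmetrization k \<Omega> u v \<and>
        (AE x in lebesgue_on \<Omega>. u (Q *v x) = v x))"

end

theory Submission
  imports Defs
begin

text \<open>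
  Write \<open>\<sigma>\<^sub>e\<close> for the reflection in the hyperplane orthogonal to the unit vector \<open>e\<close>. The hypothesis
  says that for every \<open>e\<close> either \<open>u \<ge> u \<circ> \<sigma>\<^sub>e\<close> or \<open>u \<le> u \<circ> \<sigma>\<^sub>e\<close> holds almost everywhere on the half-space
  \<open>e \<bullet> x > 0\<close>. Passing from \<open>u\<close> to \<open>f = sgn u * \<bar>u\<bar> powr p\<close>, an increasing function of \<open>u\<close>, keeps the
  hypothesis and makes the function integrable on the whole space.

  The pole is the direction \<open>P\<close> of the vector \<open>V = \<integral> f x * (x / \<bar>x\<bar>) dx\<close>. Symmetrizing the integral
  under \<open>\<sigma>\<^sub>e\<close> shows that the sign of \<open>e \<bullet> V\<close> decides between the two alternatives, and that \<open>f\<close> is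
  invariant under \<open>\<sigma>\<^sub>e\<close> if \<open>e \<bullet> V = 0\<close>. So \<open>f \<ge> f \<circ> \<sigma>\<^sub>e\<close> on \<open>e \<bullet> x > 0\<close> whenever \<open>e \<bullet> P \<ge> 0\<close>
  (\<open>exists_dominating_pole\<close>).

  If this were true at every point, two points \<open>x\<close>, \<open>y\<close> of equal norm could be compared with the one
  reflection that exchanges them: \<open>f\<close> would be a function of \<open>\<bar>x\<bar>\<close> and \<open>x \<bullet> P\<close>, nondecreasing in
  \<open>x \<bullet> P\<close>. Averages of \<open>f\<close> over balls do satisfy the inequalities everywhere
  (\<open>ball_integral_reflect_le\<close>), and along a sequence of radii they converge to \<open>f\<close> almost everywhere
  (\<open>ball_averages_converge\<close>). Hence \<open>f\<close>, and with it \<open>u\<close>, has the required profile about \<open>P\<close>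
  (\<open>exists_axial_profile\<close>).

  Finally, if \<open>Q\<close> is a rotation that carries the reference axis to \<open>P\<close>, then \<open>u \<circ> Q\<close> has a
  nonincreasing profile about this axis and the same distribution as \<open>u\<close> on each sphere. It is
  therefore the foliated Schwarz symmetrization of \<open>u\<close>.
\<close>

section \<open>Invariance of Lebesgue measure under orthogonal maps\<close>

lemma continuous_on_orthogonal:
  fixes T :: "'a::euclidean_space \<Rightarrow> 'a"
  assumes "orthogonal_transformation T"
  shows "continuous_on S T"
  using linear_continuous_on[OF linear_conv_bounded_linear[THEN iffD1,
        OF orthogonal_transformation_linear[OF assms]]] .

lemma borel_measurable_orthogonal:
  fixes T :: "'a::euclidean_space \<Rightarrow> 'a"
  assumes "orthogonal_transformation T"
  shows "T \<in> borel_measurable borel"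
  using continuous_on_orthogonal[OF assms] by (rule borel_measurable_continuous_onI)

lemma nn_integral_translate:
  fixes h :: "'a::euclidean_space \<Rightarrow> ennreal"
  assumes [measurable]: "h \<in> borel_measurable borel"
  shows "(\<integral>\<^sup>+y. h (c + y) \<partial>lborel) = (\<integral>\<^sup>+y. h y \<partial>lborel)"
  using nn_integral_distr[of "(+) c" lborel borel h] by (simp add: lborel_distr_plus)

text \<open>The uniqueness argument for Haar measure. Let \<open>f\<close> be the indicator of the unit ball, of volume
  \<open>c\<close>. Writing \<open>c \<integral> g (T y) dy\<close> as a double integral of \<open>f x * g (T y)\<close>, translating \<open>y\<close> by
  \<open>T\<^sup>-\<^sup>1 x\<close> and then \<open>x\<close> by \<open>- T y\<close> turns the integrand into \<open>f (x - T y) * g x\<close>. Because \<open>T\<close> maps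
  unit balls to unit balls, integrating over \<open>y\<close> first gives \<open>c \<integral> g\<close>.\<close>

lemma nn_integral_orthogonal:
  fixes T :: "'a::euclidean_space \<Rightarrow> 'a"
  assumes T: "orthogonal_transformation T" and g[measurable]: "g \<in> borel_measurable borel"
  shows "(\<integral>\<^sup>+x. g (T x) \<partial>lborel) = (\<integral>\<^sup>+x. g x \<partial>lborel)"
proof -
  have [measurable]: "T \<in> borel_measurable borel"
    using T by (rule borel_measurable_orthogonal)
  have lin: "linear T" using T by (rule orthogonal_transformation_linear)
  have TI: "T (inv T x) = x" for x
    using orthogonal_transformation_surj[OF T] by (rule surj_f_inv_f)
  define f :: "'a \<Rightarrow> ennreal" where "f = indicator (cball 0 1)"
  have [measurable]: "f \<in> borel_measurable borel"
    unfolding f_def by (rule borel_measurable_indicator) simp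
  define c where "c = (\<integral>\<^sup>+x. f x \<partial>lborel)"
  have c: "c = ennreal (unit_ball_vol DIM('a))"
    by (simp add: c_def f_def emeasure_cball)
  have c0: "c \<noteq> 0" "c \<noteq> top" using less_imp_neq[OF unit_ball_vol_pos[of "real DIM('a)"]] by (simp_all add: c)
  have cx: "(\<integral>\<^sup>+y. f (x - T y) \<partial>lborel) = c" for x
  proof -
    have "f (x - T y) = indicator (cball (inv T x) 1) y" for y
    proof -
      have "x - T y = T (inv T x - y)" by (simp add: linear_diff[OF lin] TI)
      then have "norm (x - T y) = dist (inv T x) y"
        by (simp add: orthogonal_transformation_norm[OF T] dist_norm)
      then show ?thesis by (simp add: f_def indicator_def)
    qed
    then show ?thesis by (simp add: c emeasure_cball)
  qed
  have "c * (\<integral>\<^sup>+y. g (T y) \<partial>lborel) = (\<integral>\<^sup>+x. f x * (\<integral>\<^sup>+y. g (T y) \<partial>lborel) \<partial>lborel)"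
    by (simp add: c_def nn_integral_multc)
  also have "\<dots> = (\<integral>\<^sup>+x. (\<integral>\<^sup>+y. f x * g (x + T y) \<partial>lborel) \<partial>lborel)"
  proof (rule nn_integral_cong)
    fix x
    have "(\<integral>\<^sup>+y. g (T y) \<partial>lborel) = (\<integral>\<^sup>+y. g (T (inv T x + y)) \<partial>lborel)"
      by (rule nn_integral_translate[symmetric]) simp
    also have "\<dots> = (\<integral>\<^sup>+y. g (x + T y) \<partial>lborel)"
      by (simp add: linear_add[OF lin] TI)
    finally show "f x * (\<integral>\<^sup>+y. g (T y) \<partial>lborel) = (\<integral>\<^sup>+y. f x * g (x + T y) \<partial>lborel)"
      by (simp add: nn_integral_cmult)
  qed
  also have "\<dots> = (\<integral>\<^sup>+y. (\<integral>\<^sup>+x. f x * g (x + T y) \<partial>lborel) \<partial>lborel)"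
    by (rule lborel_pair.Fubini') measurable
  also have "\<dots> = (\<integral>\<^sup>+y. (\<integral>\<^sup>+x. f (x - T y) * g x \<partial>lborel) \<partial>lborel)"
  proof (rule nn_integral_cong)
    fix y
    show "(\<integral>\<^sup>+x. f x * g (x + T y) \<partial>lborel) = (\<integral>\<^sup>+x. f (x - T y) * g x \<partial>lborel)"
      using nn_integral_translate[of "\<lambda>x. f (x - T y) * g x" "T y"] by (simp add: add.commute)
  qed
  also have "\<dots> = (\<integral>\<^sup>+x. (\<integral>\<^sup>+y. f (x - T y) * g x \<partial>lborel) \<partial>lborel)"
    by (rule lborel_pair.Fubini') measurable
  also have "\<dots> = c * (\<integral>\<^sup>+x. g x \<partial>lborel)"
    by (simp add: nn_integral_multc cx nn_integral_cmult)
  finally show ?thesis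
    using c0 by (simp add: ennreal_mult_cancel_left)
qed

lemma distr_lborel_orthogonal:
  fixes T :: "'a::euclidean_space \<Rightarrow> 'a"
  assumes T: "orthogonal_transformation T"
  shows "distr lborel borel T = lborel"
proof (rule measure_eqI)
  have [measurable]: "T \<in> borel_measurable borel"
    using T by (rule borel_measurable_orthogonal)
  fix A assume "A \<in> sets (distr lborel borel T)"
  then have [measurable]: "A \<in> sets borel" by simp
  have "emeasure (distr lborel borel T) A = (\<integral>\<^sup>+x. indicator A x \<partial>distr lborel borel T)"
    by simp
  also have "\<dots> = (\<integral>\<^sup>+x. indicator A (T x) \<partial>lborel)"
    by (rule nn_integral_distr) simp_all
  also have "\<dots> = emeasure lborel A"
    by (subst nn_integral_orthogonal[OF T]) simp_all
  finally show "emeasure (distr lborel borel T) A = emeasure lborel A" .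
qed simp

lemma AE_orthogonal:
  fixes T :: "'a::euclidean_space \<Rightarrow> 'a"
  assumes T: "orthogonal_transformation T" and AE: "AE x in lborel. P x"
  shows "AE x in lborel. P (T x)"
proof (rule AE_distrD[where f=T])
  show "T \<in> lborel \<rightarrow>\<^sub>M borel" using borel_measurable_orthogonal[OF T] by simp
  show "AE x in distr lborel borel T. P x" using AE unfolding distr_lborel_orthogonal[OF T] .
qed

lemma integral_orthogonal:
  fixes T :: "'a::euclidean_space \<Rightarrow> 'a" and f :: "'a \<Rightarrow> 'b::{banach,second_countable_topology}"
  assumes T: "orthogonal_transformation T" and f: "f \<in> borel_measurable borel"
  shows "(\<integral>x. f (T x) \<partial>lborel) = (\<integral>x. f x \<partial>lborel)"
  using integral_distr[of T lborel borel f] borel_measurable_orthogonal[OF T] f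
  by (simp add: distr_lborel_orthogonal[OF T])

lemma integrable_orthogonal:
  fixes T :: "'a::euclidean_space \<Rightarrow> 'a" and f :: "'a \<Rightarrow> 'b::{banach,second_countable_topology}"
  assumes T: "orthogonal_transformation T" and f: "integrable lborel f"
  shows "integrable lborel (\<lambda>x. f (T x))"
  using integrable_distr[of T lborel borel f] borel_measurable_orthogonal[OF T] f
  by (simp add: distr_lborel_orthogonal[OF T])

lemma
  fixes T :: "'a::euclidean_space \<Rightarrow> 'a"
  assumes T: "orthogonal_transformation T"
  shows measurable_lebesgue_orthogonal: "T \<in> lebesgue \<rightarrow>\<^sub>M lebesgue"
    and distr_lebesgue_orthogonal: "distr lebesgue lebesgue T = lebesgue"
proof -
  have m[measurable]: "T \<in> lborel \<rightarrow>\<^sub>M lborel"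
    using borel_measurable_orthogonal[OF T] by simp
  have d: "distr lborel lborel T = lborel"
    using distr_lborel_orthogonal[OF T] by (simp cong: distr_cong)
  have "T \<in> lebesgue \<rightarrow>\<^sub>M lborel" using m by (rule measurable_completion)
  have dl: "distr lebesgue lborel T = lborel"
    using distr_completion[OF m] d by simp
  show M: "T \<in> lebesgue \<rightarrow>\<^sub>M lebesgue"
    by (rule completion.measurable_completion2) (use \<open>T \<in> lebesgue \<rightarrow>\<^sub>M lborel\<close> dl in auto)
  show "distr lebesgue lebesgue T = lebesgue"
    using completion.completion_distr_eq[of T lborel lborel] \<open>T \<in> lebesgue \<rightarrow>\<^sub>M lborel\<close> dl by simp
qed

text \<open>The set is arbitrary: its preimage is measurable only if the set itself is, and
  \<open>emeasure\<close> takes the default value 0 on non-measurable sets.\<close>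

lemma emeasure_lebesgue_orthogonal_vimage:
  fixes T :: "'a::euclidean_space \<Rightarrow> 'a"
  assumes T: "orthogonal_transformation T"
  shows "emeasure lebesgue (T -` A) = emeasure lebesgue A"
proof (cases "A \<in> sets lebesgue")
  case True
  then have "emeasure (distr lebesgue lebesgue T) A = emeasure lebesgue (T -` A)"
    by (simp add: emeasure_distr measurable_lebesgue_orthogonal[OF T])
  then show ?thesis by (simp add: distr_lebesgue_orthogonal[OF T])
next
  case False
  have "inv T -` (T -` A) = A"
    using orthogonal_transformation_surj[OF T] by (auto simp: surj_f_inv_f)
  with False have "T -` A \<notin> sets lebesgue"
    using measurable_sets[OF measurable_lebesgue_orthogonal[OF orthogonal_transformation_inv[OF T]], of "T -` A"]
    by auto
  with False show ?thesis by (simp add: emeasure_notin_sets)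
qed

section \<open>Reflections, domination and the pole\<close>

definition reflect :: "'a::real_inner \<Rightarrow> 'a \<Rightarrow> 'a" where
  "reflect e x = x - (2 * (e \<bullet> x)) *\<^sub>R e"

lemma inner_reflect: "norm e = 1 \<Longrightarrow> e \<bullet> reflect e x = - (e \<bullet> x)"
  by (simp add: reflect_def inner_diff_right dot_square_norm)

lemma reflect_reflect: "norm e = 1 \<Longrightarrow> reflect e (reflect e x) = x"
  using inner_reflect[of e x] by (simp add: reflect_def[of e "reflect e x"]) (simp add: reflect_def)

lemma reflect_diff: "reflect e (x - y) = reflect e x - reflect e y"
  by (simp add: reflect_def inner_diff_right algebra_simps)

lemma orthogonal_transformation_reflect:
  assumes "norm e = 1"
  shows "orthogonal_transformation (reflect e)"
proof -
  have "linear (reflect e)"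
    by (rule linearI) (simp_all add: reflect_def inner_add_right algebra_simps)
  moreover have "reflect e v \<bullet> reflect e w = v \<bullet> w" for v w
    using assms by (simp add: reflect_def inner_diff_left inner_diff_right dot_square_norm inner_commute algebra_simps)
  ultimately show ?thesis by (simp add: orthogonal_transformation_def)
qed

lemma norm_reflect: "norm e = 1 \<Longrightarrow> norm (reflect e x) = norm x"
  by (rule orthogonal_transformation_norm[OF orthogonal_transformation_reflect])

lemma reflect_orthogonal_vector: "e \<bullet> x = 0 \<Longrightarrow> reflect e x = x"
  by (simp add: reflect_def)

text \<open>The bisecting hyperplane of two points on a common sphere passes through the origin. Hence
  any two values of a function on a sphere can be compared with a single reflection.\<close>

lemma reflect_swap:
  fixes x y :: "'a::real_inner"
  assumes "norm x = norm y" "x \<noteq> y"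
  shows "reflect (sgn (x - y)) x = y"
proof -
  define d where "d = x - y"
  have "d \<noteq> 0" using assms by (simp add: d_def)
  have "x \<bullet> x = y \<bullet> y" using assms(1) by (simp add: dot_square_norm)
  then have "2 * (d \<bullet> x) = d \<bullet> d"
    by (simp add: d_def inner_diff_left inner_diff_right inner_commute)
  then have "2 * (sgn d \<bullet> x) = norm d"
    using \<open>d \<noteq> 0\<close> by (simp add: sgn_div_norm dot_square_norm power2_eq_square field_simps)
  then show ?thesis
    using \<open>d \<noteq> 0\<close> unfolding reflect_def d_def[symmetric] by (simp add: sgn_div_norm d_def)
qed

text \<open>The almost everywhere form of \<open>f = f\<^sub>H\<close> for the half-space \<open>H\<close> with inner normal \<open>e\<close>.\<close>

definition dominates :: "'a::euclidean_space \<Rightarrow> ('a \<Rightarrow> real) \<Rightarrow> bool" where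
  "dominates e f \<longleftrightarrow> (AE x in lborel. 0 < e \<bullet> x \<longrightarrow> f (reflect e x) \<le> f x)"

lemma dominates_sym:
  assumes "norm e = 1" "dominates e f"
  shows "AE x in lborel. e \<bullet> x < 0 \<longrightarrow> f x \<le> f (reflect e x)"
  using AE_orthogonal[OF orthogonal_transformation_reflect[OF assms(1)] assms(2)[unfolded dominates_def]]
  by (simp add: inner_reflect[OF assms(1)] reflect_reflect[OF assms(1)])

lemma integrable_scaleR_sgn:
  fixes f :: "'a::euclidean_space \<Rightarrow> real"
  assumes "integrable lborel f"
  shows "integrable lborel (\<lambda>x. f x *\<^sub>R sgn x)"
proof (rule Bochner_Integration.integrable_bound[OF assms])
  have "f \<in> borel_measurable lborel" using assms by auto
  moreover have "(sgn :: 'a \<Rightarrow> _) \<in> borel_measurable lborel"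
    unfolding sgn_div_norm[abs_def] by measurable
  ultimately show "(\<lambda>x. f x *\<^sub>R sgn x) \<in> borel_measurable lborel" by (rule borel_measurable_scaleR)
  show "AE x in lborel. norm (f x *\<^sub>R sgn x) \<le> norm (f x)" by (auto simp: norm_sgn)
qed

text \<open>The first moment \<open>\<integral> f x * sgn x\<close> sees the asymmetry of \<open>f\<close> under every reflection at once:
  averaging its \<open>e\<close>-component with the reflected integral leaves \<open>f - f \<circ> reflect e\<close> weighted by
  an odd function.\<close>

lemma moment_reflect:
  fixes f :: "'a::euclidean_space \<Rightarrow> real"
  assumes e: "norm e = 1" and f: "integrable lborel f"
  shows "integrable lborel (\<lambda>x. (f x - f (reflect e x)) * (e \<bullet> sgn x))"
    and "(\<integral>x. (f x - f (reflect e x)) * (e \<bullet> sgn x) \<partial>lborel) = 2 * (e \<bullet> (\<integral>x. f x *\<^sub>R sgn x \<partial>lborel))"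
proof -
  note R = orthogonal_transformation_reflect[OF e]
  let ?g = "\<lambda>x. e \<bullet> (f x *\<^sub>R sgn x)"
  have g: "integrable lborel ?g" "(\<integral>x. ?g x \<partial>lborel) = e \<bullet> (\<integral>x. f x *\<^sub>R sgn x \<partial>lborel)"
    by (rule integrable_inner_right integral_inner_right, rule integrable_scaleR_sgn[OF f])+
  have gr: "integrable lborel (\<lambda>x. ?g (reflect e x))" "(\<integral>x. ?g (reflect e x) \<partial>lborel) = (\<integral>x. ?g x \<partial>lborel)"
    using integrable_orthogonal[OF R g(1)] integral_orthogonal[OF R, of ?g] g(1) by auto
  have eq: "(f x - f (reflect e x)) * (e \<bullet> sgn x) = ?g x + ?g (reflect e x)" for x
    by (simp add: sgn_div_norm norm_reflect[OF e] inner_reflect[OF e] algebra_simps)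
  show "integrable lborel (\<lambda>x. (f x - f (reflect e x)) * (e \<bullet> sgn x))"
    unfolding eq using g(1) gr(1) by (rule Bochner_Integration.integrable_add)
  show "(\<integral>x. (f x - f (reflect e x)) * (e \<bullet> sgn x) \<partial>lborel) = 2 * (e \<bullet> (\<integral>x. f x *\<^sub>R sgn x \<partial>lborel))"
    unfolding eq Bochner_Integration.integral_add[OF g(1) gr(1)] gr(2) g(2) by simp
qed

lemma inner_sgn_pos_iff: "(0 < e \<bullet> sgn x) = (0 < e \<bullet> x)" "(e \<bullet> sgn x < 0) = (e \<bullet> x < 0)"
  for e x :: "'a::real_inner"
  by (auto simp: sgn_div_norm zero_less_mult_iff mult_less_0_iff)

lemma dominates_AE_nonneg:
  assumes "norm e = 1" "dominates e f"
  shows "AE x in lborel. 0 \<le> (f x - f (reflect e x)) * (e \<bullet> sgn x)"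
  using assms(2)[unfolded dominates_def] dominates_sym[OF assms]
proof eventually_elim
  case (elim x)
  then show ?case
    using inner_sgn_pos_iff[of e x] by (auto simp: zero_le_mult_iff not_less linorder_not_le) 
qed

text \<open>The pole is the direction of the first moment \<open>V\<close>, or any direction if \<open>V = 0\<close>. If \<open>e \<bullet> V \<ge> 0\<close>
  although the reflected function dominates \<open>f\<close>, then the integrand of
  \<open>moment_reflect\<close> has constant sign and a vanishing integral, so \<open>f\<close> is symmetric under
  \<open>reflect e\<close> and domination holds in both directions.\<close>

lemma exists_dominating_pole:
  fixes f :: "'a::euclidean_space \<Rightarrow> real"
  assumes f: "integrable lborel f"
    and alt: "\<And>e. norm e = 1 \<Longrightarrow> dominates e f \<or> dominates e (\<lambda>x. - f x)"
  obtains P where "norm P = 1" "\<And>e. norm e = 1 \<Longrightarrow> 0 \<le> e \<bullet> P \<Longrightarrow> dominates e f"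
proof -
  define V where "V = (\<integral>x. f x *\<^sub>R sgn x \<partial>lborel)"
  obtain P0 :: "'a" where P0: "norm P0 = 1"
    using vector_choose_size[of 1] by auto
  define P where "P = (if V = 0 then P0 else sgn V)"
  have VP: "V = norm V *\<^sub>R P" by (simp add: P_def sgn_div_norm)
  have "dominates e f" if e: "norm e = 1" and eP: "0 \<le> e \<bullet> P" for e
  proof (cases "dominates e f")
    case False
    with alt[OF e] have D: "dominates e (\<lambda>x. - f x)" by simp
    have nn: "AE x in lborel. 0 \<le> - ((f x - f (reflect e x)) * (e \<bullet> sgn x))"
      using dominates_AE_nonneg[OF e D] by eventually_elim (simp add: algebra_simps)
    note m = moment_reflect[OF e f]
    have "0 \<le> e \<bullet> V" using eP by (subst VP) simp
    moreover have "0 \<le> (\<integral>x. - ((f x - f (reflect e x)) * (e \<bullet> sgn x)) \<partial>lborel)"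
      using nn by (rule integral_nonneg_AE)
    ultimately have "(\<integral>x. - ((f x - f (reflect e x)) * (e \<bullet> sgn x)) \<partial>lborel) = 0"
      using m by (simp add: V_def)
    then have "AE x in lborel. - ((f x - f (reflect e x)) * (e \<bullet> sgn x)) = 0"
      using integral_nonneg_eq_0_iff_AE[OF integrable_minus[OF m(1)] nn] by simp
    then show ?thesis
      unfolding dominates_def
    proof eventually_elim
      case (elim x)
      then show ?case using inner_sgn_pos_iff(1)[of e x] by auto
    qed
  qed
  moreover have "norm P = 1" using P0 by (simp add: P_def norm_sgn)
  ultimately show ?thesis using that by blast
qed

section \<open>Ball integrals of a dominating function\<close>

lemma reflect_dist_diff:
  fixes e x y :: "'a::real_inner"
  assumes e: "norm e = 1"
  shows "(dist (reflect e y) x)\<^sup>2 - (dist y x)\<^sup>2 = 4 * (e \<bullet> x) * (e \<bullet> y)"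
proof -
  have ee: "e \<bullet> e = 1" using e by (simp add: dot_square_norm)
  have eq: "reflect e y - x = (y - x) - (2 * (e \<bullet> y)) *\<^sub>R e" by (simp add: reflect_def)
  show ?thesis
    unfolding dist_norm power2_norm_eq_inner eq
    by (simp add: ee inner_diff_left inner_diff_right inner_commute algebra_simps)
qed

definition ball_integral :: "real \<Rightarrow> ('a::euclidean_space \<Rightarrow> real) \<Rightarrow> 'a \<Rightarrow> real" where
  "ball_integral \<delta> f x = (\<integral>y. indicator (cball x \<delta>) y * f y \<partial>lborel)"

text \<open>Averaging keeps domination, because a point \<open>x\<close> of the half-space is at least as close to
  any point of the half-space as to its mirror image. The gain is that the almost everywhere
  inequality becomes one at every point.\<close>

lemma ball_integral_reflect_le:
  fixes f :: "'a::euclidean_space \<Rightarrow> real"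
  assumes f: "integrable lborel f" and e: "norm e = 1" and D: "dominates e f"
    and x: "0 \<le> e \<bullet> x"
  shows "ball_integral \<delta> f (reflect e x) \<le> ball_integral \<delta> f x"
proof -
  note R = orthogonal_transformation_reflect[OF e]
  note fr = integrable_orthogonal[OF R f]
  let ?k = "\<lambda>y. indicator (cball x \<delta>) y :: real"
  have [measurable]: "f \<in> borel_measurable borel" using f by auto
  have [measurable]: "reflect e \<in> borel_measurable borel" using R by (rule borel_measurable_orthogonal)
  have [measurable]: "?k \<in> borel_measurable borel" by (rule borel_measurable_indicator) simp
  have [measurable]: "(\<lambda>y. ?k (reflect e y)) \<in> borel_measurable borel" by (rule measurable_compose) measurable
  have kr: "indicator (cball (reflect e x) \<delta>) (reflect e y) = ?k y" for y
    using norm_reflect[OF e, of "x - y"] by (simp add: indicator_def dist_norm reflect_diff)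
  have kr': "indicator (cball (reflect e x) \<delta>) y = ?k (reflect e y)" for y
    using kr[of "reflect e y"] by (simp add: reflect_reflect[OF e])
  have i: "integrable lborel (\<lambda>y. ?k y * f y)" "integrable lborel (\<lambda>y. ?k y * f (reflect e y))"
    "integrable lborel (\<lambda>y. ?k (reflect e y) * f y)" "integrable lborel (\<lambda>y. ?k (reflect e y) * f (reflect e y))"
    by (rule Bochner_Integration.integrable_bound[OF f], measurable, simp add: indicator_def)
      (rule Bochner_Integration.integrable_bound[OF fr], measurable, simp add: indicator_def,
       rule Bochner_Integration.integrable_bound[OF f], measurable, simp add: indicator_def,
       rule Bochner_Integration.integrable_bound[OF fr], measurable, simp add: indicator_def)
  have 1: "ball_integral \<delta> f (reflect e x) = (\<integral>y. ?k (reflect e y) * f y \<partial>lborel)"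
    by (simp add: ball_integral_def kr')
  have 2: "ball_integral \<delta> f (reflect e x) = (\<integral>y. ?k y * f (reflect e y) \<partial>lborel)"
    unfolding 1 by (subst integral_orthogonal[OF R, symmetric]) (simp_all add: reflect_reflect[OF e])
  have 3: "ball_integral \<delta> f x = (\<integral>y. ?k y * f y \<partial>lborel)"
    by (simp add: ball_integral_def)
  have 4: "ball_integral \<delta> f x = (\<integral>y. ?k (reflect e y) * f (reflect e y) \<partial>lborel)"
    unfolding 3 by (subst integral_orthogonal[OF R, symmetric]) simp_all
  \<comment> \<open>Both values are written twice, once substituting \<open>reflect e y\<close> for \<open>y\<close>, so that the
    difference becomes the integral of a product of two factors of equal sign.\<close>
  have "2 * (ball_integral \<delta> f x - ball_integral \<delta> f (reflect e x)) =
    (\<integral>y. (?k y - ?k (reflect e y)) * (f y - f (reflect e y)) \<partial>lborel)"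
  proof -
    have "(?k y - ?k (reflect e y)) * (f y - f (reflect e y)) = (?k y * f y + ?k (reflect e y) * f (reflect e y))
       - (?k (reflect e y) * f y + ?k y * f (reflect e y))" for y by (simp add: algebra_simps)
    then have "(\<integral>y. (?k y - ?k (reflect e y)) * (f y - f (reflect e y)) \<partial>lborel) =
      ((\<integral>y. ?k y * f y \<partial>lborel) + (\<integral>y. ?k (reflect e y) * f (reflect e y) \<partial>lborel))
       - ((\<integral>y. ?k (reflect e y) * f y \<partial>lborel) + (\<integral>y. ?k y * f (reflect e y) \<partial>lborel))"
      using i by simp
    then show ?thesis
      unfolding 1[symmetric] 2[symmetric] 3[symmetric] 4[symmetric] by simp
  qed
  moreover have "AE y in lborel. 0 \<le> (?k y - ?k (reflect e y)) * (f y - f (reflect e y))"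
    using D[unfolded dominates_def] dominates_sym[OF e D]
  proof eventually_elim
    case (elim y)
    have sq: "(dist (reflect e y) x)\<^sup>2 - (dist y x)\<^sup>2 = 4 * (e \<bullet> x) * (e \<bullet> y)"
      by (rule reflect_dist_diff[OF e])
    consider "e \<bullet> y > 0" | "e \<bullet> y < 0" | "e \<bullet> y = 0" by linarith
    then show ?case
    proof cases
      case 1
      then have "0 \<le> 4 * (e \<bullet> x) * (e \<bullet> y)" using x by simp
      then have "(dist y x)\<^sup>2 \<le> (dist (reflect e y) x)\<^sup>2" using sq by linarith
      then have "dist y x \<le> dist (reflect e y) x" by (rule power2_le_imp_le) simp
      then have "?k (reflect e y) \<le> ?k y" by (auto simp: indicator_def dist_commute)
      moreover have "f (reflect e y) \<le> f y" using elim 1 by blast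
      ultimately show ?thesis by (intro mult_nonneg_nonneg) simp_all
    next
      case 2
      then have "4 * (e \<bullet> x) * (e \<bullet> y) \<le> 0" using x by (simp add: mult_nonneg_nonpos)
      then have "(dist (reflect e y) x)\<^sup>2 \<le> (dist y x)\<^sup>2" using sq by linarith
      then have "dist (reflect e y) x \<le> dist y x" by (rule power2_le_imp_le) simp
      then have "?k y \<le> ?k (reflect e y)" by (auto simp: indicator_def dist_commute)
      moreover have "f y \<le> f (reflect e y)" using elim 2 by blast
      ultimately show ?thesis by (intro mult_nonpos_nonpos) simp_all
    next
      case 3
      then show ?thesis by (simp add: reflect_orthogonal_vector)
    qed
  qed
  then have "0 \<le> (\<integral>y. (?k y - ?k (reflect e y)) * (f y - f (reflect e y)) \<partial>lborel)"
    by (rule integral_nonneg_AE)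
  ultimately have "0 \<le> 2 * (ball_integral \<delta> f x - ball_integral \<delta> f (reflect e x))"
    by (simp only:)
  then show ?thesis by simp
qed

text \<open>The reflection that exchanges \<open>x\<close> and \<open>y\<close> has normal \<open>sgn (x - y)\<close>, which makes an angle of at most
  \<open>pi / 2\<close> with the pole exactly when \<open>y \<bullet> P \<le> x \<bullet> P\<close>. So on each sphere about the origin the ball
  integrals depend only on the height above the equator, monotonically.\<close>

lemma ball_integral_mono:
  fixes f :: "'a::euclidean_space \<Rightarrow> real"
  assumes f: "integrable lborel f"
    and D: "\<And>e. norm e = 1 \<Longrightarrow> 0 \<le> e \<bullet> P \<Longrightarrow> dominates e f"
    and xy: "norm x = norm y" "y \<bullet> P \<le> x \<bullet> P"
  shows "ball_integral \<delta> f y \<le> ball_integral \<delta> f x"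
proof (cases "x = y")
  case False
  define e where "e = sgn (x - y)"
  have e: "norm e = 1" using False by (simp add: e_def norm_sgn)
  have "0 \<le> e \<bullet> P"
    using xy(2) by (simp add: e_def sgn_div_norm inner_diff_left)
  moreover have "0 \<le> e \<bullet> x"
  proof -
    have "x \<bullet> y \<le> norm x * norm y" by (rule norm_cauchy_schwarz)
    then have "0 \<le> (x - y) \<bullet> x"
      using xy(1) by (simp add: inner_diff_left dot_square_norm[of x] power2_eq_square inner_commute[of y x])
    then show ?thesis by (simp add: e_def sgn_div_norm)
  qed
  ultimately have "ball_integral \<delta> f (reflect e x) \<le> ball_integral \<delta> f x"
    using ball_integral_reflect_le[OF f e] D[OF e] by blast
  then show ?thesis using reflect_swap[OF xy(1) False] by (simp add: e_def)
qed simp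

section \<open>Almost everywhere convergence of ball averages\<close>

lemma integrable_translate:
  fixes f :: "'a::euclidean_space \<Rightarrow> 'b::{banach,second_countable_topology}"
  assumes "integrable lborel f"
  shows "integrable lborel (\<lambda>x. f (x + z))"
  using integrable_distr[of "(+) z" lborel borel f] assms by (simp add: lborel_distr_plus add.commute)

lemma integral_translate:
  fixes f :: "'a::euclidean_space \<Rightarrow> 'b::{banach,second_countable_topology}"
  assumes "f \<in> borel_measurable borel"
  shows "(\<integral>x. f (x + z) \<partial>lborel) = (\<integral>x. f x \<partial>lborel)"
  using integral_distr[of "(+) z" lborel borel f] assms by (simp add: lborel_distr_plus add.commute)

text \<open>For an open set \<open>U\<close> the indicators of \<open>U \<inter> (U - z)\<close> converge pointwise to that of \<open>U\<close> as \<open>z\<close>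
  tends to 0, with no condition on the boundary: points outside \<open>U\<close> contribute nothing. The
  measure of the symmetric difference follows, since \<open>U\<close> and \<open>U - z\<close> have equal measure.\<close>

lemma L1_continuity_of_translation_open:
  fixes U :: "'a::euclidean_space set"
  assumes U: "open U" and fin: "emeasure lborel U < \<infinity>" and z: "z \<longlonglongrightarrow> 0"
  shows "(\<lambda>n. \<integral>x. \<bar>indicator U (x + z n) - indicator U x :: real\<bar> \<partial>lborel) \<longlonglongrightarrow> 0"
proof -
  let ?u = "indicator U :: 'a \<Rightarrow> real"
  have [measurable]: "U \<in> sets borel" using U by simp
  have [measurable]: "?u \<in> borel_measurable borel" by measurable
  have iu: "integrable lborel ?u" using fin by simp
  have iut: "integrable lborel (\<lambda>x. ?u (x + z n))" for n by (rule integrable_translate[OF iu])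
  have ip: "integrable lborel (\<lambda>x. ?u x * ?u (x + z n))" for n
    by (rule Bochner_Integration.integrable_bound[OF iu]) (auto simp: indicator_def)
  have lim: "(\<lambda>n. \<integral>x. ?u x * ?u (x + z n) \<partial>lborel) \<longlonglongrightarrow> (\<integral>x. ?u x \<partial>lborel)"
  proof (rule integral_dominated_convergence[OF _ _ iu])
    show "AE x in lborel. (\<lambda>n. ?u x * ?u (x + z n)) \<longlonglongrightarrow> ?u x"
    proof (rule AE_I2)
      fix x
      show "(\<lambda>n. ?u x * ?u (x + z n)) \<longlonglongrightarrow> ?u x"
      proof (cases "x \<in> U")
        case True
        have "(\<lambda>n. x + z n) \<longlonglongrightarrow> x + 0" using z by (intro tendsto_intros)
        then have "eventually (\<lambda>n. x + z n \<in> U) sequentially"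
          using U True by (simp add: topological_tendstoD)
        then have "eventually (\<lambda>n. ?u x * ?u (x + z n) = ?u x) sequentially"
          by eventually_elim simp
        then show ?thesis by (rule tendsto_eventually)
      qed simp
    qed
  qed (auto simp: indicator_def)
  have eq: "(\<integral>x. \<bar>?u (x + z n) - ?u x\<bar> \<partial>lborel)
    = 2 * (\<integral>x. ?u x \<partial>lborel) - 2 * (\<integral>x. ?u x * ?u (x + z n) \<partial>lborel)" for n
  proof -
    have "\<bar>?u (x + z n) - ?u x\<bar> = (?u x + ?u (x + z n)) - 2 * (?u x * ?u (x + z n))" for x
      by (simp add: indicator_def)
    then have "(\<integral>x. \<bar>?u (x + z n) - ?u x\<bar> \<partial>lborel)
      = ((\<integral>x. ?u x \<partial>lborel) + (\<integral>x. ?u (x + z n) \<partial>lborel)) - 2 * (\<integral>x. ?u x * ?u (x + z n) \<partial>lborel)"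
      using iu iut[of n] ip[of n] by simp
    then show ?thesis using integral_translate[of ?u "z n"] by simp
  qed
  have "(\<lambda>n. 2 * (\<integral>x. ?u x \<partial>lborel) - 2 * (\<integral>x. ?u x * ?u (x + z n) \<partial>lborel)) \<longlonglongrightarrow>
     2 * (\<integral>x. ?u x \<partial>lborel) - 2 * (\<integral>x. ?u x \<partial>lborel)"
    using lim by (intro tendsto_intros)
  then show ?thesis unfolding eq by simp
qed

text \<open>Translation does not change the distance of two functions in \<open>L\<^sup>1\<close>. This lemma serves
  the passage from open to measurable sets and from simple to
  integrable functions.\<close>

lemma L1_approximation_imp_continuity_of_translation:
  fixes f :: "'a::euclidean_space \<Rightarrow> 'b::{banach,second_countable_topology}"
  assumes f: "integrable lborel f"
    and approx: "\<And>\<epsilon>. 0 < \<epsilon> \<Longrightarrow> \<exists>g. integrable lborel g \<and> (\<integral>x. norm (g x - f x) \<partial>lborel) \<le> \<epsilon> \<and>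
      (\<lambda>n. \<integral>x. norm (g (x + z n) - g x) \<partial>lborel) \<longlonglongrightarrow> 0"
  shows "(\<lambda>n. \<integral>x. norm (f (x + z n) - f x) \<partial>lborel) \<longlonglongrightarrow> 0"
proof (rule LIMSEQ_I)
  fix r :: real assume "0 < r"
  then obtain g where g: "integrable lborel g" "(\<integral>x. norm (g x - f x) \<partial>lborel) \<le> r / 4"
    and lim: "(\<lambda>n. \<integral>x. norm (g (x + z n) - g x) \<partial>lborel) \<longlonglongrightarrow> 0"
    using approx[of "r / 4"] by auto
  obtain N where N: "\<And>n. n \<ge> N \<Longrightarrow> (\<integral>x. norm (g (x + z n) - g x) \<partial>lborel) < r / 2"
    using LIMSEQ_D[OF lim, of "r / 2"] \<open>0 < r\<close> by force
  have "(\<integral>x. norm (f (x + z n) - f x) \<partial>lborel) < r" if "n \<ge> N" for n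
  proof -
    have d: "integrable lborel (\<lambda>x. norm (g x - f x))" using f g by simp
    note dt = integrable_translate[OF d, of "z n"]
    have gt: "integrable lborel (\<lambda>x. norm (g (x + z n) - g x))"
      using g(1) integrable_translate[OF g(1), of "z n"] by simp
    have ft: "integrable lborel (\<lambda>x. norm (f (x + z n) - f x))"
      using f integrable_translate[OF f, of "z n"] by simp
    have "(\<integral>x. norm (f (x + z n) - f x) \<partial>lborel) \<le>
      (\<integral>x. (norm (g (x + z n) - f (x + z n)) + norm (g (x + z n) - g x)) + norm (g x - f x) \<partial>lborel)"
    proof (rule integral_mono[OF ft])
      show "integrable lborel (\<lambda>x. (norm (g (x + z n) - f (x + z n)) + norm (g (x + z n) - g x)) + norm (g x - f x))"
        by (intro Bochner_Integration.integrable_add d dt gt)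
      fix x
      have "f (x + z n) - f x = (g (x + z n) - g x) - (g (x + z n) - f (x + z n)) + (g x - f x)" by simp
      then show "norm (f (x + z n) - f x) \<le>
         (norm (g (x + z n) - f (x + z n)) + norm (g (x + z n) - g x)) + norm (g x - f x)"
        by (smt (verit) norm_triangle_ineq norm_triangle_ineq4)
    qed
    also have "\<dots> = (\<integral>x. norm (g (x + z n) - f (x + z n)) \<partial>lborel) + (\<integral>x. norm (g (x + z n) - g x) \<partial>lborel)
       + (\<integral>x. norm (g x - f x) \<partial>lborel)"
      using d dt gt by simp
    also have "(\<integral>x. norm (g (x + z n) - f (x + z n)) \<partial>lborel) = (\<integral>x. norm (g x - f x) \<partial>lborel)"
      using borel_measurable_integrable[OF d] by (intro integral_translate) simp
    finally show ?thesis using g(2) N[OF that] by linarith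
  qed
  then show "\<exists>no. \<forall>n\<ge>no. norm ((\<integral>x. norm (f (x + z n) - f x) \<partial>lborel) - 0) < r"
    by (intro exI[of _ N]) simp
qed

lemma L1_continuity_of_translation:
  fixes f :: "'a::euclidean_space \<Rightarrow> real"
  assumes f: "integrable lborel f" and z: "z \<longlonglongrightarrow> 0"
  shows "(\<lambda>n. \<integral>x. norm (f (x + z n) - f x) \<partial>lborel) \<longlonglongrightarrow> 0"
  using f
proof (induction rule: integrable_induct)
  case (base A c)
  have A: "A \<in> sets borel" "emeasure lborel A < \<infinity>" using base by simp_all
  have iA: "integrable lborel (\<lambda>x. indicator A x *\<^sub>R c)" using A by simp
  show ?case
  proof (rule L1_approximation_imp_continuity_of_translation[OF iA])
    fix \<epsilon> :: real assume \<epsilon>: "0 < \<epsilon>"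
    define \<eta> where "\<eta> = \<epsilon> / (\<bar>c\<bar> + 1)"
    have "\<eta> > 0" using \<epsilon> by (simp add: \<eta>_def)
    then obtain U where U: "open U" "A \<subseteq> U" "emeasure lborel (U - A) < ennreal \<eta>"
      using outer_regular_lborel[OF A(1)] by blast
    have [measurable]: "U \<in> sets borel" "A \<in> sets borel" using U A by auto
    have "emeasure lborel U \<le> emeasure lborel A + emeasure lborel (U - A)"
      using emeasure_subadditive[of A lborel "U - A"] U(2) by (simp add: Un_absorb1)
    also have "\<dots> < \<infinity>" using A(2) less_trans[OF U(3) ennreal_less_top] by (simp add: ennreal_add_less_top)
    finally have finU: "emeasure lborel U < \<infinity>" .
    let ?g = "\<lambda>x. indicator U x *\<^sub>R c"
    have gi: "integrable lborel ?g" using finU by simp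
    moreover have "(\<integral>x. norm (?g x - indicator A x *\<^sub>R c) \<partial>lborel) \<le> \<epsilon>"
    proof -
      have "norm (?g x - indicator A x *\<^sub>R c) = \<bar>c\<bar> * indicator (U - A) x" for x
        using U(2) by (auto simp: indicator_def)
      then have "(\<integral>x. norm (?g x - indicator A x *\<^sub>R c) \<partial>lborel) = \<bar>c\<bar> * measure lborel (U - A)"
        by simp
      also have "\<dots> \<le> \<bar>c\<bar> * \<eta>"
        using U(3) \<open>\<eta> > 0\<close> by (intro mult_left_mono) (auto simp: measure_def intro!: enn2real_leI)
      also have "\<dots> \<le> \<epsilon>" using \<epsilon> by (simp add: \<eta>_def field_simps)
      finally show ?thesis .
    qed
    moreover have "(\<lambda>n. \<integral>x. norm (?g (x + z n) - ?g x) \<partial>lborel) \<longlonglongrightarrow> 0"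
    proof -
      have "norm (?g (x + z n) - ?g x) = \<bar>indicator U (x + z n) - indicator U x\<bar> * \<bar>c\<bar>" for x n
        by (simp add: left_diff_distrib[symmetric] abs_mult)
      moreover have "(\<lambda>n. (\<integral>x. \<bar>indicator U (x + z n) - indicator U x :: real\<bar> \<partial>lborel) * \<bar>c\<bar>) \<longlonglongrightarrow> 0 * \<bar>c\<bar>"
        by (intro tendsto_intros L1_continuity_of_translation_open U finU z)
      ultimately show ?thesis by simp
    qed
    ultimately show "\<exists>g. integrable lborel g \<and> (\<integral>x. norm (g x - indicator A x *\<^sub>R c) \<partial>lborel) \<le> \<epsilon> \<and>
      (\<lambda>n. \<integral>x. norm (g (x + z n) - g x) \<partial>lborel) \<longlonglongrightarrow> 0" by blast
  qed
next
  case (add f g)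
  note ft = integrable_translate[OF add.hyps(1)] and gt = integrable_translate[OF add.hyps(2)]
  show ?case
  proof (rule tendsto_sandwich[OF _ _ tendsto_const])
    show "(\<lambda>n. (\<integral>x. norm (f (x + z n) - f x) \<partial>lborel) + (\<integral>x. norm (g (x + z n) - g x) \<partial>lborel)) \<longlonglongrightarrow> 0"
      using tendsto_add[OF add.IH] by simp
    show "\<forall>\<^sub>F n in sequentially. (\<integral>x. norm (f (x + z n) + g (x + z n) - (f x + g x)) \<partial>lborel) \<le>
      (\<integral>x. norm (f (x + z n) - f x) \<partial>lborel) + (\<integral>x. norm (g (x + z n) - g x) \<partial>lborel)"
    proof (rule always_eventually, rule allI)
      fix n
      have "(\<integral>x. norm (f (x + z n) + g (x + z n) - (f x + g x)) \<partial>lborel) \<le>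
        (\<integral>x. norm (f (x + z n) - f x) + norm (g (x + z n) - g x) \<partial>lborel)"
        using ft[of "z n"] gt[of "z n"] add.hyps
        by (intro integral_mono integrable_norm Bochner_Integration.integrable_add Bochner_Integration.integrable_diff)
           auto
      then show "(\<integral>x. norm (f (x + z n) + g (x + z n) - (f x + g x)) \<partial>lborel) \<le>
        (\<integral>x. norm (f (x + z n) - f x) \<partial>lborel) + (\<integral>x. norm (g (x + z n) - g x) \<partial>lborel)"
        using ft[of "z n"] gt[of "z n"] add.hyps by simp
    qed
  qed auto
next
  case (lim f s)
  show ?case
  proof (rule L1_approximation_imp_continuity_of_translation[OF lim.hyps(4)])
    fix \<epsilon> :: real assume "0 < \<epsilon>"
    have [measurable]: "f \<in> borel_measurable borel" "\<And>i. s i \<in> borel_measurable borel"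
      using lim.hyps(1,4) by auto
    have "(\<lambda>i. \<integral>x. norm (s i x - f x) \<partial>lborel) \<longlonglongrightarrow> (\<integral>x. 0 \<partial>(lborel::'a measure))"
    proof (rule integral_dominated_convergence[where w = "\<lambda>x. 3 * norm (f x)"])
      show "integrable lborel (\<lambda>x. 3 * norm (f x))" using lim.hyps(4) by simp
      show "AE x in lborel. (\<lambda>i. norm (s i x - f x)) \<longlonglongrightarrow> 0"
      proof (rule AE_I2)
        fix x :: 'a
        have "(\<lambda>i. s i x) \<longlonglongrightarrow> f x" using lim.hyps(2)[of x] by simp
        then show "(\<lambda>i. norm (s i x - f x)) \<longlonglongrightarrow> 0"
          by (intro tendsto_norm_zero LIM_zero)
      qed
      show "AE x in lborel. norm (norm (s i x - f x)) \<le> 3 * norm (f x)" for i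
      proof (rule AE_I2)
        fix x :: 'a
        show "norm (norm (s i x - f x)) \<le> 3 * norm (f x)"
          using lim.hyps(3)[of x i] norm_triangle_ineq4[of "s i x" "f x"] by simp
      qed
    qed simp_all
    then obtain i where "(\<integral>x. norm (s i x - f x) \<partial>lborel) < \<epsilon>"
      using LIMSEQ_D[of _ 0 \<epsilon>] \<open>0 < \<epsilon>\<close> by (force dest: LIMSEQ_D[of _ 0 \<epsilon>])
    then show "\<exists>g. integrable lborel g \<and> (\<integral>x. norm (g x - f x) \<partial>lborel) \<le> \<epsilon> \<and>
      (\<lambda>n. \<integral>x. norm (g (x + z n) - g x) \<partial>lborel) \<longlonglongrightarrow> 0"
      using lim.hyps(1) lim.IH by (intro exI[of _ "s i"]) auto
  qed
qed

definition ball_average :: "real \<Rightarrow> ('a::euclidean_space \<Rightarrow> real) \<Rightarrow> 'a \<Rightarrow> real" where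
  "ball_average \<delta> f x = ball_integral \<delta> f x / measure lborel (cball (0::'a) \<delta>)"

text \<open>Exchanging the order of integration bounds the distance of \<open>f\<close> to its ball average by the
  average distance of \<open>f\<close> to its translates.\<close>

lemma
  fixes f :: "'a::euclidean_space \<Rightarrow> real"
  assumes f: "integrable lborel f" and \<delta>: "0 < \<delta>"
    and close: "\<And>z. norm z \<le> \<delta> \<Longrightarrow> (\<integral>x. \<bar>f (x + z) - f x\<bar> \<partial>lborel) \<le> \<epsilon>"
  shows integrable_ball_average_diff: "integrable lborel (\<lambda>x. ball_average \<delta> f x - f x)"
    and L1_ball_average_le: "(\<integral>x. norm (ball_average \<delta> f x - f x) \<partial>lborel) \<le> \<epsilon>"
proof -
  let ?B = "cball (0::'a) \<delta>"
  define m where "m = measure lborel ?B"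
  have finB: "emeasure lborel ?B < \<infinity>" using emeasure_cball[of \<delta> "0::'a"] \<delta> by simp
  have "m \<noteq> 0"
    using \<delta> less_imp_neq[OF unit_ball_vol_pos[of "real DIM('a)"]]
    by (simp add: m_def measure_def emeasure_cball)
  then have m: "0 < m" using measure_nonneg[of lborel ?B] by (simp add: m_def less_le)
  define k where "k = (\<lambda>z. indicator ?B z / m :: real)"
  have [measurable]: "f \<in> borel_measurable borel" using f by auto
  have [measurable]: "k \<in> borel_measurable borel"
    unfolding k_def by (intro borel_measurable_divide borel_measurable_indicator borel_measurable_const) simp
  have k0: "0 \<le> k z" for z using m by (simp add: k_def)
  have ki: "integrable lborel k" using finB by (simp add: k_def)
  have k1: "(\<integral>z. k z \<partial>lborel) = 1" using m by (simp add: k_def m_def)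
  have k1': "(\<integral>\<^sup>+z. ennreal (k z) \<partial>lborel) = 1"
    using nn_integral_eq_integral[OF ki] k0 k1 by simp
  have kfi: "integrable lborel (\<lambda>z. k z * f (z + x))" for x
  proof (rule Bochner_Integration.integrable_bound)
    show "integrable lborel (\<lambda>z. f (z + x) / m)" using integrable_translate[OF f, of x] by simp
    show "AE z in lborel. norm (k z * f (z + x)) \<le> norm (f (z + x) / m)"
      by (rule AE_I2) (simp add: k_def indicator_def)
  qed measurable
  have avg: "ball_average \<delta> f x = (\<integral>z. k z * f (z + x) \<partial>lborel)" for x
  proof -
    have "(\<lambda>y. indicator (cball x \<delta>) y * f y) \<in> borel_measurable borel"
      by (intro borel_measurable_times borel_measurable_indicator) (simp_all, measurable)
    then have "ball_integral \<delta> f x = (\<integral>z. indicator (cball x \<delta>) (z + x) * f (z + x) \<partial>lborel)"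
      unfolding ball_integral_def by (rule integral_translate[symmetric])
    also have "\<dots> = (\<integral>z. m * (k z * f (z + x)) \<partial>lborel)"
      using m by (intro Bochner_Integration.integral_cong) (simp_all add: k_def indicator_def dist_norm)
    also have "\<dots> = m * (\<integral>z. k z * f (z + x) \<partial>lborel)" by simp
    finally show ?thesis using m by (simp add: ball_average_def m_def)
  qed
  have [measurable]: "ball_average \<delta> f \<in> borel_measurable borel"
  proof -
    have "ball_average \<delta> f = (\<lambda>x. \<integral>z. k z * f (z + x) \<partial>lborel)" using avg by (rule ext)
    moreover have "(\<lambda>x. \<integral>z. k z * f (z + x) \<partial>lborel) \<in> borel_measurable borel"
      by (rule lborel.borel_measurable_lebesgue_integral) measurable
    ultimately show ?thesis by simp
  qed
  have diff: "ball_average \<delta> f x - f x = (\<integral>z. k z * (f (z + x) - f x) \<partial>lborel)"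
    and kdi: "integrable lborel (\<lambda>z. k z * (f (z + x) - f x))" for x
    using kfi[of x] ki k1 by (simp_all add: avg right_diff_distrib)
  have le: "(\<integral>\<^sup>+x. norm (ball_average \<delta> f x - f x) \<partial>lborel) \<le> ennreal \<epsilon>"
  proof -
    have "(\<integral>\<^sup>+x. norm (ball_average \<delta> f x - f x) \<partial>lborel) \<le>
      (\<integral>\<^sup>+x. (\<integral>\<^sup>+z. ennreal (k z) * ennreal \<bar>f (x + z) - f x\<bar> \<partial>lborel) \<partial>lborel)"
    proof (rule nn_integral_mono)
      fix x
      have "ennreal (norm (ball_average \<delta> f x - f x)) \<le> (\<integral>\<^sup>+z. ennreal (norm (k z * (f (z + x) - f x))) \<partial>lborel)"
        unfolding diff by (rule integral_norm_bound_ennreal[OF kdi])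
      then show "ennreal (norm (ball_average \<delta> f x - f x)) \<le>
         (\<integral>\<^sup>+z. ennreal (k z) * ennreal \<bar>f (x + z) - f x\<bar> \<partial>lborel)"
        using k0 by (simp add: abs_mult ennreal_mult add.commute)
    qed
    also have "\<dots> = (\<integral>\<^sup>+z. (\<integral>\<^sup>+x. ennreal (k z) * ennreal \<bar>f (x + z) - f x\<bar> \<partial>lborel) \<partial>lborel)"
      by (rule lborel_pair.Fubini') measurable
    also have "\<dots> \<le> (\<integral>\<^sup>+z. ennreal \<epsilon> * ennreal (k z) \<partial>lborel)"
    proof (rule nn_integral_mono)
      fix z :: 'a
      have i: "integrable lborel (\<lambda>x. \<bar>f (x + z) - f x\<bar>)"
        using f integrable_translate[OF f, of z] by simp
      have "(\<integral>\<^sup>+x. ennreal (k z) * ennreal \<bar>f (x + z) - f x\<bar> \<partial>lborel) =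
        ennreal (k z) * (\<integral>\<^sup>+x. ennreal \<bar>f (x + z) - f x\<bar> \<partial>lborel)"
        by (rule nn_integral_cmult) measurable
      also have "\<dots> = ennreal (k z) * ennreal (\<integral>x. \<bar>f (x + z) - f x\<bar> \<partial>lborel)"
        by (subst nn_integral_eq_integral[OF i]) auto
      also have "\<dots> \<le> ennreal (k z) * ennreal \<epsilon>"
      proof (cases "norm z \<le> \<delta>")
        case True
        then show ?thesis using close by (intro mult_left_mono ennreal_leI) auto
      qed (simp add: k_def)
      finally show "(\<integral>\<^sup>+x. ennreal (k z) * ennreal \<bar>f (x + z) - f x\<bar> \<partial>lborel) \<le> ennreal \<epsilon> * ennreal (k z)"
        by (simp add: mult.commute)
    qed
    also have "\<dots> = ennreal \<epsilon>"
      by (subst nn_integral_cmult) (simp_all add: k1')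
    finally show ?thesis .
  qed
  show int: "integrable lborel (\<lambda>x. ball_average \<delta> f x - f x)"
    using le by (intro integrableI_bounded) (auto intro: le_less_trans)
  have "0 \<le> \<epsilon>" using close[of 0] \<delta> by simp
  then show "(\<integral>x. norm (ball_average \<delta> f x - f x) \<partial>lborel) \<le> \<epsilon>"
    using le nn_integral_eq_integral[OF integrable_norm[OF int]] by simp
qed

text \<open>Along a sequence of radii, \<open>L\<^sup>1\<close> convergence gives almost everywhere convergence; this is as
  much of the Lebesgue differentiation theorem as is needed to recover \<open>f\<close> from its averages.\<close>

lemma ball_averages_converge:
  fixes f :: "'a::euclidean_space \<Rightarrow> real"
  assumes f: "integrable lborel f"
  obtains \<delta> :: "nat \<Rightarrow> real" where "AE x in lborel. (\<lambda>n. ball_average (\<delta> n) f x) \<longlonglongrightarrow> f x"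
proof -
  define \<omega> where "\<omega> z = (\<integral>x. \<bar>f (x + z) - f x\<bar> \<partial>lborel)" for z
  have "\<omega> \<midarrow>0\<rightarrow> 0"
    unfolding LIMSEQ_SEQ_conv[symmetric]
    using L1_continuity_of_translation[OF f] by (auto simp: \<omega>_def comp_def)
  have "\<exists>\<delta>>0. \<forall>z. norm z \<le> \<delta> \<longrightarrow> \<omega> z \<le> \<epsilon>" if \<epsilon>: "0 < \<epsilon>" for \<epsilon>
  proof -
    obtain s where s: "s > 0" "\<And>z. z \<noteq> 0 \<Longrightarrow> norm z < s \<Longrightarrow> \<bar>\<omega> z\<bar> < \<epsilon>"
      using LIM_D[OF \<open>\<omega> \<midarrow>0\<rightarrow> 0\<close> \<epsilon>] by auto
    have "\<omega> z \<le> \<epsilon>" if "norm z \<le> s / 2" for z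
    proof (cases "z = 0")
      case True
      then show ?thesis using \<epsilon> by (simp add: \<omega>_def)
    next
      case False
      then show ?thesis using s(2)[of z] s(1) that by auto
    qed
    then show ?thesis using s(1) by (intro exI[of _ "s / 2"]) auto
  qed
  then have "\<forall>n. \<exists>\<delta>>0. \<forall>z. norm z \<le> \<delta> \<longrightarrow> \<omega> z \<le> 1 / real (Suc n)" by simp
  then obtain \<delta> where \<delta>: "\<And>n. 0 < \<delta> n" "\<And>n z. norm z \<le> \<delta> n \<Longrightarrow> \<omega> z \<le> 1 / real (Suc n)"
    by metis
  have int: "integrable lborel (\<lambda>x. ball_average (\<delta> n) f x - f x)"
    and le: "(\<integral>x. norm (ball_average (\<delta> n) f x - f x) \<partial>lborel) \<le> 1 / real (Suc n)" for n
    by (rule integrable_ball_average_diff[OF f \<delta>(1)], rule \<delta>(2)[unfolded \<omega>_def], assumption)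
      (rule L1_ball_average_le[OF f \<delta>(1)], rule \<delta>(2)[unfolded \<omega>_def], assumption)
  have "(\<lambda>n. \<integral>x. norm (ball_average (\<delta> n) f x - f x) \<partial>lborel) \<longlonglongrightarrow> 0"
  proof (rule tendsto_sandwich[OF always_eventually always_eventually tendsto_const])
    show "(\<lambda>n. 1 / real (Suc n)) \<longlonglongrightarrow> 0"
      using LIMSEQ_Suc[OF lim_1_over_n[where 'a=real]] by simp
    show "\<forall>n. 0 \<le> (\<integral>x. norm (ball_average (\<delta> n) f x - f x) \<partial>lborel)" by simp
    show "\<forall>n. (\<integral>x. norm (ball_average (\<delta> n) f x - f x) \<partial>lborel) \<le> 1 / real (Suc n)"
      using le by blast
  qed
  from tendsto_L1_AE_subseq[OF int this] obtain r :: "nat \<Rightarrow> nat"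
    where "AE x in lborel. (\<lambda>n. ball_average (\<delta> (r n)) f x - f x) \<longlonglongrightarrow> 0" by auto
  then have "AE x in lborel. (\<lambda>n. ball_average (\<delta> (r n)) f x) \<longlonglongrightarrow> f x"
    by eventually_elim (simp add: LIM_zero_iff)
  then show ?thesis by (rule that[of "\<lambda>n. \<delta> (r n)"])
qed

section \<open>The profile about the pole\<close>

lemma negligible_iff_AE_lborel: "negligible S \<longleftrightarrow> (AE x in lborel. x \<notin> S)"
proof
  assume "AE x in lborel. x \<notin> S"
  then have "AE x in lebesgue. x \<notin> S" by (rule AE_completion_iff[THEN iffD2])
  then obtain N where "N \<in> null_sets lebesgue" "S \<subseteq> N"
    by (auto simp: eventually_ae_filter)
  then show "negligible S"
    by (metis negligible_iff_null_sets negligible_subset)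
next
  assume "negligible S"
  then have "AE x in lebesgue. x \<notin> S" by (simp add: negligible_iff_null_sets AE_not_in)
  then show "AE x in lborel. x \<notin> S" by (rule AE_completion_iff[THEN iffD1])
qed

text \<open>If a radial set meets a cone about \<open>P\<close> in a null set, then it is null: it is locally null,
  because near any of its points it is an orthogonal image of a part of its intersection with
  the cone. This does the work of integration in polar coordinates.\<close>

lemma negligible_radial_hull_of_cone:
  fixes P :: "'a::euclidean_space"
  assumes B: "negligible B" and P: "norm P = 1" and q: "q < 1"
  shows "negligible {x :: 'a. \<forall>y. norm y = norm x \<and> q * norm y < P \<bullet> y \<longrightarrow> y \<in> B}"
proof -
  define S where "S = {x :: 'a. \<forall>y. norm y = norm x \<and> q * norm y < P \<bullet> y \<longrightarrow> y \<in> B} - {0}"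
  have "negligible S"
  proof (rule locally_negligible_alt[THEN iffD2], rule ballI)
    fix x assume x: "x \<in> S"
    then have "norm x = norm (norm x *\<^sub>R P)" using P by simp
    obtain T where T: "orthogonal_transformation T" "T x = norm x *\<^sub>R P"
    proof (cases "x = norm x *\<^sub>R P")
      case True
      then show ?thesis using that[of "\<lambda>x. x"] by simp
    next
      case False
      then have e: "norm (sgn (x - norm x *\<^sub>R P)) = 1" by (simp add: norm_sgn)
      show ?thesis
        using orthogonal_transformation_reflect[OF e] reflect_swap[OF \<open>norm x = _\<close> False] by (rule that)
    qed
    have nT: "norm (T y) = norm y" for y using T(1) by (rule orthogonal_transformation_norm)
    define U where "U = S \<inter> {y. q * norm y < P \<bullet> T y}"
    have "open {y. q * norm y < P \<bullet> T y}"
      by (intro open_Collect_less continuous_intros continuous_on_orthogonal[OF T(1)])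
    then have "openin (top_of_set S) U" unfolding U_def by (rule openin_open_Int)
    moreover have "x \<in> U"
      using x q P T(2) by (auto simp: U_def S_def dot_square_norm)
    moreover have "negligible U"
    proof (rule negligible_subset)
      show "negligible {y. T y \<in> B}"
        using AE_orthogonal[OF T(1) B[unfolded negligible_iff_AE_lborel]]
        by (simp add: negligible_iff_AE_lborel)
      show "U \<subseteq> {y. T y \<in> B}"
        by (auto simp: U_def S_def nT)
    qed
    ultimately show "\<exists>U. openin (top_of_set S) U \<and> x \<in> U \<and> negligible U" by blast
  qed
  then have "negligible (insert 0 S)" by (rule negligible_insert[THEN iffD2])
  then show ?thesis by (rule negligible_subset) (auto simp: S_def)
qed

text \<open>For orthonormal \<open>P\<close> and \<open>Q\<close> this is the point at distance \<open>r\<close> from the origin and angle \<open>\<theta>\<close> from \<open>P\<close>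
  in the half-plane spanned by \<open>P\<close> and \<open>Q\<close>.\<close>

definition profile_point :: "'a::real_normed_vector \<Rightarrow> 'a \<Rightarrow> real \<Rightarrow> real \<Rightarrow> 'a" where
  "profile_point P Q r \<theta> = r *\<^sub>R (cos \<theta> *\<^sub>R P + sin \<theta> *\<^sub>R Q)"

text \<open>Take the lower limit \<open>L\<close> of ball averages along a suitable sequence of radii. It equals \<open>f\<close> almost
  everywhere, and by \<open>ball_integral_mono\<close> it is at every point a monotone function of the height
  on the sphere. The profile is the restriction of \<open>L\<close> to a half-plane through the pole.

  The lower limit may be infinite, whereas the profile has to be real. If \<open>L\<close> is infinite at some
  interior angle of the sphere of radius \<open>r\<close>, monotonicity makes it infinite on a whole cap about
  \<open>P\<close> or about \<open>- P\<close>. Such points form a null set \<open>B\<close>, so by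
  \<open>negligible_radial_hull_of_cone\<close> the spheres in question form a null set, and the profile can
  be set to 0 on them.\<close>

lemma exists_axial_profile:
  fixes f :: "'a::euclidean_space \<Rightarrow> real"
  assumes dim: "2 \<le> DIM('a)" and f: "integrable lborel f" and P: "norm P = 1"
    and D: "\<And>e. norm e = 1 \<Longrightarrow> 0 \<le> e \<bullet> P \<Longrightarrow> dominates e f"
  obtains w :: "real \<Rightarrow> real \<Rightarrow> real" where
    "\<And>r. 0 \<le> r \<Longrightarrow> antimono_on {0<..<pi} (w r)"
    "AE x in lborel. f x = w (norm x) (arccos (P \<bullet> x / norm x))"
proof -
  obtain \<delta> :: "nat \<Rightarrow> real" where lim: "AE x in lborel. (\<lambda>n. ball_average (\<delta> n) f x) \<longlonglongrightarrow> f x"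
    using ball_averages_converge[OF f] .
  obtain Q :: 'a where "Q \<noteq> 0" "orthogonal P Q"
    using orthogonal_to_vector_exists[OF dim] by metis
  then obtain Q0 :: 'a where Q0: "norm Q0 = 1" "P \<bullet> Q0 = 0"
    using that[of "sgn Q"] by (metis inner_scaleR_right mult_zero_right norm_sgn orthogonal_def sgn_div_norm)
  define L where "L x = liminf (\<lambda>n. ereal (ball_average (\<delta> n) f x))" for x
  have L_mono: "L y \<le> L x" if "norm x = norm y" "P \<bullet> y \<le> P \<bullet> x" for x y
    unfolding L_def
  proof (intro Liminf_mono always_eventually allI)
    fix n
    have "ball_integral (\<delta> n) f y \<le> ball_integral (\<delta> n) f x"
      using f D that(1) that(2)[unfolded inner_commute[of P]] by (rule ball_integral_mono)
    then show "ereal (ball_average (\<delta> n) f y) \<le> ereal (ball_average (\<delta> n) f x)"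
      by (simp add: ball_average_def divide_right_mono)
  qed
  then have L_cong: "L x = L y" if "norm x = norm y" "P \<bullet> x = P \<bullet> y" for x y
    using that by (intro antisym) auto
  have L_eq: "AE x in lborel. L x = ereal (f x)"
    using lim
  proof eventually_elim
    case (elim x)
    then have "(\<lambda>n. ereal (ball_average (\<delta> n) f x)) \<longlonglongrightarrow> ereal (f x)" by simp
    then show ?case unfolding L_def by (rule lim_imp_Liminf[OF sequentially_bot])
  qed
  define B where "B = {x. \<bar>L x\<bar> = \<infinity>}"
  have B: "negligible B"
  proof -
    have "AE x in lborel. x \<notin> B"
      using L_eq by eventually_elim (simp add: B_def)
    then show ?thesis by (simp add: negligible_iff_AE_lborel)
  qed
  let ?x = "profile_point P Q0"
  have nP: "P \<bullet> P = 1" "Q0 \<bullet> Q0 = 1" using P Q0 by (simp_all add: dot_square_norm)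
  have Px: "P \<bullet> ?x r \<theta> = r * cos \<theta>" for r \<theta>
    using Q0 by (simp add: profile_point_def inner_add_right nP)
  have nx: "norm (?x r \<theta>) = \<bar>r\<bar>" for r \<theta>
  proof -
    have "(cos \<theta> *\<^sub>R P + sin \<theta> *\<^sub>R Q0) \<bullet> (cos \<theta> *\<^sub>R P + sin \<theta> *\<^sub>R Q0) = 1"
      using Q0(2) nP by (simp add: inner_add_left inner_add_right inner_commute[of Q0 P] power2_eq_square[symmetric])
    then have "norm (cos \<theta> *\<^sub>R P + sin \<theta> *\<^sub>R Q0) = 1" by (simp add: norm_eq_1)
    then show ?thesis by (simp add: profile_point_def)
  qed
  define good where "good r \<longleftrightarrow> (\<forall>\<theta>\<in>{0<..<pi}. \<bar>L (?x r \<theta>)\<bar> \<noteq> \<infinity>)" for r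
  define w where "w r \<theta> = (if good r then real_of_ereal (L (?x r \<theta>)) else 0)" for r \<theta>
  have anti: "antimono_on {0<..<pi} (w r)" if r: "0 \<le> r" for r
  proof (rule monotone_onI)
    fix a b assume ab: "a \<in> {0<..<pi}" "b \<in> {0<..<pi}" "a \<le> b"
    show "w r b \<le> w r a"
    proof (cases "good r")
      case True
      have "cos b \<le> cos a" using ab by (intro cos_monotone_0_pi_le) auto
      then have "L (?x r b) \<le> L (?x r a)"
        using r by (intro L_mono) (simp_all add: nx Px mult_left_mono)
      moreover have "\<bar>L (?x r a)\<bar> \<noteq> \<infinity>" "\<bar>L (?x r b)\<bar> \<noteq> \<infinity>"
        using True ab by (auto simp: good_def)
      ultimately show ?thesis
        using True by (cases "L (?x r a)"; cases "L (?x r b)") (auto simp: w_def)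
    qed (simp add: w_def)
  qed
  define cone where "cone A q = {x :: 'a. \<forall>y. norm y = norm x \<and> q * norm y < A \<bullet> y \<longrightarrow> y \<in> B}" for A q
  \<comment> \<open>Rational heights suffice, which keeps the union of exceptional sets countable.\<close>
  define Qs where "Qs = \<rat> \<inter> {-1<..<1::real}"
  have cones: "negligible (\<Union>q\<in>Qs. cone P q \<union> cone (- P) q)"
  proof (rule negligible_countable_Union)
    show "countable ((\<lambda>q. cone P q \<union> cone (- P) q) ` Qs)"
      unfolding Qs_def by (intro countable_image countable_Int1 countable_rat)
    fix S assume "S \<in> (\<lambda>q. cone P q \<union> cone (- P) q) ` Qs"
    then obtain q where q: "q < 1" "S = cone P q \<union> cone (- P) q" by (auto simp: Qs_def)
    show "negligible S"
      unfolding q(2) cone_def using P q(1)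
      by (intro negligible_Un negligible_radial_hull_of_cone B) simp_all
  qed
  have bad: "\<exists>q\<in>Qs. x \<in> cone P q \<union> cone (- P) q" if notgood: "\<not> good (norm x)" for x
  proof -
    obtain \<theta> where \<theta>: "0 < \<theta>" "\<theta> < pi" "\<bar>L (?x (norm x) \<theta>)\<bar> = \<infinity>"
      using notgood by (auto simp: good_def)
    have c: "-1 < cos \<theta>" "cos \<theta> < 1"
      using cos_monotone_0_pi[of 0 \<theta>] cos_monotone_0_pi[of \<theta> pi] \<theta> by auto
    show ?thesis
    proof (cases "L (?x (norm x) \<theta>) = \<infinity>")
      case True
      obtain q where q: "q \<in> \<rat>" "cos \<theta> < q" "q < 1" using Rats_dense_in_real[OF c(2)] by auto
      have "x \<in> cone P q"
        unfolding cone_def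
      proof (intro CollectI allI impI)
        fix y assume y: "norm y = norm x \<and> q * norm y < P \<bullet> y"
        have "q * norm x < P \<bullet> y" using y by metis
        moreover have "norm x * cos \<theta> \<le> q * norm x"
          using q(2) mult_left_mono[of "cos \<theta>" q "norm x"] by (simp add: mult.commute)
        ultimately have "norm x * cos \<theta> \<le> P \<bullet> y" by linarith
        then have "L (?x (norm x) \<theta>) \<le> L y"
          using conjunct1[OF y] by (intro L_mono) (simp_all add: nx Px)
        then show "y \<in> B" using True by (simp add: B_def)
      qed
      then show ?thesis using q c by (intro bexI[of _ q]) (auto simp: Qs_def)
    next
      case False
      then have M: "L (?x (norm x) \<theta>) = - \<infinity>" using \<theta>(3) by (cases "L (?x (norm x) \<theta>)") auto
      obtain q where q: "q \<in> \<rat>" "- cos \<theta> < q" "q < 1" using Rats_dense_in_real[of "- cos \<theta>" 1] c by auto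
      have "x \<in> cone (- P) q"
        unfolding cone_def
      proof (intro CollectI allI impI)
        fix y assume y: "norm y = norm x \<and> q * norm y < - P \<bullet> y"
        have "q * norm x < - (P \<bullet> y)" using y by (metis inner_minus_left)
        moreover have "- (norm x * cos \<theta>) \<le> q * norm x"
          using q(2) mult_left_mono[of "- cos \<theta>" q "norm x"] by (simp add: mult.commute)
        ultimately have "P \<bullet> y \<le> norm x * cos \<theta>" by linarith
        then have "L y \<le> L (?x (norm x) \<theta>)"
          using conjunct1[OF y] by (intro L_mono) (simp_all add: nx Px)
        then show "y \<in> B" using M by (simp add: B_def)
      qed
      then show ?thesis using q c by (intro bexI[of _ q]) (auto simp: Qs_def)
    qed
  qed
  have "AE x in (lborel :: 'a measure). good (norm x)"
    using cones[unfolded negligible_iff_AE_lborel]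
  proof eventually_elim
    case (elim x)
    then show ?case using bad[of x] by blast
  qed
  with L_eq have "AE x in lborel. f x = w (norm x) (arccos (P \<bullet> x / norm x))"
  proof eventually_elim
    case (elim x)
    have "\<bar>P \<bullet> x\<bar> \<le> norm x" using Cauchy_Schwarz_ineq2[of P x] P by simp
    then have "-1 \<le> P \<bullet> x / norm x" "P \<bullet> x / norm x \<le> 1"
      by (cases "x = 0"; simp add: field_simps abs_le_iff)+
    then have "norm x * cos (arccos (P \<bullet> x / norm x)) = P \<bullet> x" by simp
    then have "L (?x (norm x) (arccos (P \<bullet> x / norm x))) = L x"
      by (intro L_cong) (simp_all add: nx Px)
    then show ?case using elim by (simp add: w_def)
  qed
  with anti show ?thesis by (rule that)
qed

section \<open>Two-point rearrangements and foliated Schwarz symmetry\<close>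

text \<open>For \<open>p > 0\<close> an increasing bijection of the real line, which turns functions in \<open>L\<^sup>p\<close> into integrable ones.\<close>

definition signed_powr :: "real \<Rightarrow> real \<Rightarrow> real" where
  "signed_powr p t = sgn t * \<bar>t\<bar> powr p"

lemma signed_powr_mono:
  assumes "0 < p" "s \<le> t"
  shows "signed_powr p s \<le> signed_powr p t"
proof -
  consider "0 \<le> s" | "s < 0" "0 \<le> t" | "t < 0" using assms(2) by linarith
  then show ?thesis
  proof cases
    case 1
    then have "s powr p \<le> t powr p" using assms by (intro powr_mono2) auto
    then show ?thesis using 1 assms by (auto simp: signed_powr_def sgn_if)
  next
    case 2
    then have "signed_powr p s \<le> 0" "0 \<le> signed_powr p t" by (auto simp: signed_powr_def sgn_if)
    then show ?thesis by linarith
  next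
    case 3
    then have "(- t) powr p \<le> (- s) powr p" using assms by (intro powr_mono2) auto
    then show ?thesis using 3 assms by (auto simp: signed_powr_def sgn_if)
  qed
qed

lemma signed_powr_inverse:
  assumes "0 < p"
  shows "signed_powr (1 / p) (signed_powr p t) = t"
  using assms by (cases "t = 0") (auto simp: signed_powr_def sgn_if powr_powr abs_mult)

lemma abs_signed_powr: "\<bar>signed_powr p t\<bar> = \<bar>t\<bar> powr p"
  by (auto simp: signed_powr_def sgn_if abs_mult)

lemma halfspace_in_half_spaces0:
  fixes e :: "'a::euclidean_space"
  assumes "norm e = 1"
  shows "{x. 0 < e \<bullet> x} \<in> half_spaces0"
proof -
  have "e \<noteq> 0" using assms by auto
  then have "frontier {x. 0 < e \<bullet> x} = {x. e \<bullet> x = 0}" by (intro frontier_halfspace_gt) simp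
  with \<open>e \<noteq> 0\<close> show ?thesis unfolding half_spaces0_def by force
qed

lemma reflection_halfspace:
  fixes e :: "'a::euclidean_space"
  assumes e: "norm e = 1"
  shows "reflection {x. 0 < e \<bullet> x} = reflect e"
proof
  fix x
  have ee: "e \<bullet> e = 1" using e by (simp add: dot_square_norm)
  let ?y = "x - (e \<bullet> x) *\<^sub>R e"
  have "frontier {x. 0 < e \<bullet> x} = {x. e \<bullet> x = 0}"
    using e by (intro frontier_halfspace_gt) auto
  moreover have "?y = closest_point {x. e \<bullet> x = 0} x"
  proof (rule closest_point_unique)
    show "\<forall>z\<in>{x. e \<bullet> x = 0}. dist x ?y \<le> dist x z"
    proof
      fix z assume "z \<in> {x. e \<bullet> x = 0}"
      then have "\<bar>e \<bullet> x\<bar> = \<bar>e \<bullet> (x - z)\<bar>" by (simp add: inner_diff_right)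
      also have "\<dots> \<le> norm (x - z)" using Cauchy_Schwarz_ineq2[of e "x - z"] e by simp
      finally show "dist x ?y \<le> dist x z" using e by (simp add: dist_norm)
    qed
  qed (simp_all add: convex_hyperplane closed_hyperplane inner_diff_right ee)
  ultimately have "reflection {x. 0 < e \<bullet> x} x = 2 *\<^sub>R ?y - x"
    by (simp add: reflection_def)
  then show "reflection {x. 0 < e \<bullet> x} x = reflect e x"
    by (simp add: reflect_def scaleR_diff_right scaleR_2 flip: scaleR_scaleR)
qed

lemma AE_lebesgue_iff_lborel: "(AE x in lebesgue. R x) \<longleftrightarrow> (AE x in lborel. R x)"
  by (rule AE_completion_iff)

theorem theorem3p1:
  fixes \<Omega> :: "(real ^ 'n) set" and u :: "real ^ 'n \<Rightarrow> real" and p :: real and k :: 'n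
  assumes "CARD('n) \<ge> 2"
    and "open \<Omega>" and "connected \<Omega>" and "\<Omega> \<noteq> {}" and "radially_symmetric \<Omega>"
    and "1 \<le> p" and "in_Lp p \<Omega> u"
    and "\<And>H. H \<in> half_spaces0 \<Longrightarrow>
      (AE x in lebesgue. zero_extension \<Omega> u x =
         two_point_rearrangement H (zero_extension \<Omega> u) x) \<or>
      (AE x in lebesgue. zero_extension \<Omega> u (reflection H x) =
         two_point_rearrangement H (zero_extension \<Omega> u) x)"
  shows "\<exists>P \<in> sphere 0 1. foliated_schwarz_symmetric k \<Omega> u P"
proof -
  define g where "g = zero_extension \<Omega> u"
  have p: "0 < p" using assms(6) by simp
  have \<Omega>: "\<Omega> \<in> sets lebesgue" using assms(2) by (simp add: borel_open)
  have u: "u \<in> borel_measurable (lebesgue_on \<Omega>)" "integrable (lebesgue_on \<Omega>) (\<lambda>x. \<bar>u x\<bar> powr p)"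
    using assms(7) by (simp_all add: in_Lp_def)
  have g_meas: "g \<in> borel_measurable lebesgue"
    using borel_measurable_if_I[OF u(1) \<Omega>] by (simp add: g_def zero_extension_def)
  \<comment> \<open>\<open>h\<close> is integrable and a strictly increasing function of \<open>g\<close>.\<close>
  define h where "h x = signed_powr p (g x)" for x
  have "integrable lebesgue (\<lambda>x. indicator \<Omega> x *\<^sub>R (\<bar>u x\<bar> powr p))"
    using u(2) \<Omega> by (simp add: integrable_restrict_space)
  moreover have h_meas: "h \<in> borel_measurable lebesgue"
    unfolding h_def[abs_def] signed_powr_def sgn_if using g_meas by measurable
  moreover have "norm (h x) \<le> norm (indicator \<Omega> x *\<^sub>R (\<bar>u x\<bar> powr p))" for x
    by (simp add: h_def abs_signed_powr g_def zero_extension_def)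
  ultimately have h_int: "integrable lebesgue h"
    by (rule Bochner_Integration.integrable_bound[OF _ _ AE_I2])
  \<comment> \<open>A Borel representative, so that iterated integrals can be used.\<close>
  obtain f where f_meas: "f \<in> borel_measurable lborel" and hf: "AE x in lborel. h x = f x"
    using completion_ex_borel_measurable_real[OF h_meas] by auto
  have "integrable lebesgue f"
    using integrable_cong_AE[OF h_meas measurable_completion[OF f_meas] AE_completion[OF hf]] h_int
    by (rule iffD1)
  then have f: "integrable lborel f" by (rule integrable_completion[OF f_meas, THEN iffD1])
  have alt: "dominates e f \<or> dominates e (\<lambda>x. - f x)" if e: "norm e = 1" for e
  proof -
    let ?H = "{x. 0 < e \<bullet> x}"
    note hf' = AE_orthogonal[OF orthogonal_transformation_reflect[OF e] hf]
    from assms(8)[OF halfspace_in_half_spaces0[OF e]]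
    consider "AE x in lborel. g x = two_point_rearrangement ?H g x"
      | "AE x in lborel. g (reflect e x) = two_point_rearrangement ?H g x"
      unfolding g_def[symmetric] reflection_halfspace[OF e] AE_lebesgue_iff_lborel by blast
    then show ?thesis
    proof cases
      case 1
      with hf hf' have "AE x in lborel. 0 < e \<bullet> x \<longrightarrow> f (reflect e x) \<le> f x"
      proof eventually_elim
        case (elim x)
        show ?case
        proof
          assume "0 < e \<bullet> x"
          then have "g (reflect e x) \<le> g x"
            using elim(3) by (simp add: two_point_rearrangement_def reflection_halfspace[OF e])
          then show "f (reflect e x) \<le> f x"
            using signed_powr_mono[OF p, of "g (reflect e x)" "g x"] elim(1,2) by (simp add: h_def)
        qed
      qed
      then show ?thesis by (simp add: dominates_def)
    next
      case 2
      with hf hf' have "AE x in lborel. 0 < e \<bullet> x \<longrightarrow> f x \<le> f (reflect e x)"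
      proof eventually_elim
        case (elim x)
        show ?case
        proof
          assume "0 < e \<bullet> x"
          then have "g x \<le> g (reflect e x)"
            using elim(3) by (simp add: two_point_rearrangement_def reflection_halfspace[OF e])
          then show "f x \<le> f (reflect e x)"
            using signed_powr_mono[OF p, of "g x" "g (reflect e x)"] elim(1,2) by (simp add: h_def)
        qed
      qed
      then show ?thesis by (simp add: dominates_def)
    qed
  qed
  obtain P where P: "norm P = 1" "\<And>e. norm e = 1 \<Longrightarrow> 0 \<le> e \<bullet> P \<Longrightarrow> dominates e f"
    using exists_dominating_pole[OF f alt] by blast
  have dim: "2 \<le> DIM(real ^ 'n)" using assms(1) by simp
  obtain w where w: "\<And>r. 0 \<le> r \<Longrightarrow> antimono_on {0<..<pi} (w r)"
    "AE x in lborel. f x = w (norm x) (arccos (P \<bullet> x / norm x))"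
    using exists_axial_profile[OF dim f P] by blast
  obtain Q where Q: "rotation_matrix Q" "Q *v axis k 1 = P"
    using rotation_matrix_exists_basis[OF assms(1) P(1)] .
  have T: "orthogonal_transformation ((*v) Q)"
    using Q(1) by (simp add: rotation_matrix_def orthogonal_transformation_matrix)
  have nT: "norm (Q *v x) = norm x" for x using orthogonal_transformation_norm[OF T] .
  have \<Omega>T: "Q *v x \<in> \<Omega> \<longleftrightarrow> x \<in> \<Omega>" for x
    using assms(5) nT[of x] unfolding radially_symmetric_def by metis
  have PT: "P \<bullet> (Q *v x) = x $ k" for x
  proof -
    have "P \<bullet> (Q *v x) = axis k 1 \<bullet> x"
      using T by (simp add: Q(2)[symmetric] orthogonal_transformation_def)
    then show ?thesis by (simp add: inner_axis')
  qed
  \<comment> \<open>The symmetrization of \<open>u\<close> is \<open>u\<close> itself, rotated such that its pole becomes the \<open>k\<close>-th axis.\<close>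
  define v where "v x = u (Q *v x)" for x
  have gv: "g (Q *v x) = v x" if "x \<in> \<Omega>" for x
    using that by (simp add: g_def zero_extension_def v_def \<Omega>T)
  have "is_foliated_schwarz_symmetrization k \<Omega> u v"
    unfolding is_foliated_schwarz_symmetrization_def
  proof (intro conjI exI[of _ "\<lambda>r \<theta>. signed_powr (1 / p) (w r \<theta>)"] allI impI)
    have "(\<lambda>x. g (Q *v x)) \<in> borel_measurable (lebesgue_on \<Omega>)"
      using measurable_compose[OF measurable_lebesgue_orthogonal[OF T] g_meas]
      by (rule measurable_restrict_space1)
    then show "v \<in> borel_measurable (lebesgue_on \<Omega>)"
      by (rule measurable_cong[THEN iffD1, rotated]) (simp add: gv)
    fix r :: real assume "0 \<le> r"
    show "antimono_on {0<..<pi} (\<lambda>\<theta>. signed_powr (1 / p) (w r \<theta>))"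
      using w(1)[OF \<open>0 \<le> r\<close>] p unfolding monotone_on_def by (auto intro: signed_powr_mono)
  next
    have "AE x in lborel. x \<in> \<Omega> \<longrightarrow> v x = signed_powr (1 / p) (w (norm x) (arccos (x $ k / norm x)))"
      using AE_orthogonal[OF T hf] AE_orthogonal[OF T w(2)]
    proof eventually_elim
      case (elim x)
      then have "h (Q *v x) = w (norm x) (arccos (x $ k / norm x))" by (simp add: nT PT)
      then have "g (Q *v x) = signed_powr (1 / p) (w (norm x) (arccos (x $ k / norm x)))"
        using signed_powr_inverse[OF p, of "g (Q *v x)"] by (simp add: h_def)
      then show ?case using gv by auto
    qed
    then show "AE x in lebesgue_on \<Omega>. v x = signed_powr (1 / p) (w (norm x) (arccos (x $ k / norm x)))"
      using \<Omega> by (simp add: AE_restrict_space_iff AE_lebesgue_iff_lborel)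
  next
    show "AE r in lborel. 0 \<le> r \<longrightarrow> (\<forall>a b. a < b \<longrightarrow>
           sphere_measure r {x \<in> \<Omega>. a < u x \<and> u x \<le> b \<and> norm x = r} =
           sphere_measure r {x \<in> \<Omega>. a < v x \<and> v x \<le> b \<and> norm x = r})"
    proof (intro AE_I2 impI allI)
      fix r a b :: real
      define A where "A = {x \<in> \<Omega>. a < u x \<and> u x \<le> b \<and> norm x = r}"
      have "{x \<in> \<Omega>. a < v x \<and> v x \<le> b \<and> norm x = r} = (*v) Q -` A"
        by (auto simp: A_def v_def nT \<Omega>T)
      moreover have "{y. 0 < norm y \<and> norm y < 1 \<and> (r / norm y) *\<^sub>R y \<in> (*v) Q -` A} =
        (*v) Q -` {y. 0 < norm y \<and> norm y < 1 \<and> (r / norm y) *\<^sub>R y \<in> A}"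
        by (simp add: vimage_def nT matrix_vector_mult_scaleR del: zero_less_norm_iff)
      ultimately show "sphere_measure r {x \<in> \<Omega>. a < u x \<and> u x \<le> b \<and> norm x = r} =
           sphere_measure r {x \<in> \<Omega>. a < v x \<and> v x \<le> b \<and> norm x = r}"
        unfolding A_def[symmetric] sphere_measure_def
        by (simp only: emeasure_lebesgue_orthogonal_vimage[OF T])
    qed
  qed
  then have "foliated_schwarz_symmetric k \<Omega> u P"
    unfolding foliated_schwarz_symmetric_def using Q by (intro exI[of _ Q] exI[of _ v]) (simp add: v_def)
  then show ?thesis using P(1) by (intro bexI[of _ P]) auto
qed

end
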